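(* If $\mathfrak a<\mathfrak s$, then there exists a fin-intersecting MAD family on $\omega$. In particular, if $\mathfrak a<\mathfrak s$, there are pseudocompact MAD families.
   Context: An almost disjoint family on $\omega$ is an infinite set $\mathcal A$ of infinite subsets of $\omega$ such that $a\cap b$ is finite for all distinct $a,b\in\mathcal A$; it is MAD if it is not properly contained in any other almost disjoint family on $\omega$. $\mathfrak a$ is the least cardinality of a MAD family on $\omega$. $\mathfrak s$ is the least cardinality of a collection $\mathcal S$ of infinite subsets of $\omega$ such that for every infinite $X\subseteq\omega$ there is $S\in\mathcal S$ with both $X\cap S$ and $X\setminus S$ infinite. A fin sequence is a function $C:\omega\to[\omega]^{<\omega}\setminus\{\emptyset\}$ with $C(n)\cap C(m)=\emptyset$ whenever $n\neq m$. A collection of sets is centered if every finite nonempty subcollection has infinite intersection. An almost disjoint family $\mathcal A$ is fin-intersecting if for every fin sequence $C$ there exists an infinite $I\subseteq\omega$ such that $\{\{n\in I: a\cap C(n)\neq\emptyset\}: a\in\mathcal A\}\setminus[I]^{<\omega}$ is centered, where $[I]^{<\omega}$ is the set of finite subsets of $I$. The space $\Psi(\mathcal A)$ is the set $\omega\cup\mathcal A$ (a disjoint union) with the topology having as a basis $\{\{n\}:n\in\omega\}\cup\{\{a\}\cup(a\setminus F): a\in\mathcal A,\ F\in[\omega]^{<\omega}\}$. For a $T_1$ space $X$, $\exp(X)$ is the set of nonempty closed subsets of $X$ with the Vietoris topology, i.e. the topology generated by all sets $U^+=\{F\in\exp(X): F\subseteq U\}$ and $U^-=\{F\in\exp(X):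 F\cap U\neq\emptyset\}$ for $U\subseteq X$ open. A topological space is pseudocompact if every continuous real-valued function on it is bounded. An almost disjoint family $\mathcal A$ is called pseudocompact if $\exp(\Psi(\mathcal A))$ is pseudocompact. *)

theory Defs
  imports "HOL-Analysis.Analysis" "HOL-Library.Disjoint_Sets" "HOL-Library.Countable_Set"
begin

unbundle cardinal_syntax

section \<open>Almost disjoint families and fin-intersecting families\<close>

definition almost_disjoint_family :: "nat set set \<Rightarrow> bool" where
  "almost_disjoint_family A \<longleftrightarrow>
     infinite A \<and> (\<forall>a\<in>A. infinite a) \<and> pairwise (\<lambda>a b. finite (a \<inter> b)) A"

definition MAD_family :: "nat set set \<Rightarrow> bool" where
  "MAD_family A \<longleftrightarrow>
     almost_disjoint_family A \<and> \<not> (\<exists>B. almost_disjoint_family B \<and> A \<subset> B)"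

definition splitting_family :: "nat set set \<Rightarrow> bool" where
  "splitting_family S \<longleftrightarrow>
     (\<forall>s\<in>S. infinite s) \<and>
     (\<forall>X. infinite X \<longrightarrow> (\<exists>s\<in>S. infinite (X \<inter> s) \<and> infinite (X - s)))"

definition fin_sequence :: "(nat \<Rightarrow> nat set) \<Rightarrow> bool" where
  "fin_sequence C \<longleftrightarrow> (\<forall>n. finite (C n) \<and> C n \<noteq> {}) \<and> disjoint_family C"

definition centered :: "'a set set \<Rightarrow> bool" where
  "centered S \<longleftrightarrow> (\<forall>F. F \<subseteq> S \<and> finite F \<and> F \<noteq> {} \<longrightarrow> infinite (\<Inter>F))"

definition fin_intersecting :: "nat set set \<Rightarrow> bool" where
  "fin_intersecting A \<longleftrightarrow>
     (\<forall>C. fin_sequence C \<longrightarrow>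
       (\<exists>I. infinite I \<and> centered ((\<lambda>a. {n \<in> I. a \<inter> C n \<noteq> {}}) ` A - Fpow I)))"


section \<open>The cardinals a and s\<close>

text \<open>Cardinals are cardinal orders, compared up to isomorphism by \<open>\<le>o\<close> and \<open><o\<close>.
  The value of \<open>least_card P\<close> is meaningful only if some set satisfies \<open>P\<close>; for the two
  instances below this is shown by \<open>MAD_family_exists\<close> and \<open>splitting_family_exists\<close>.\<close>

definition least_card :: "('a set \<Rightarrow> bool) \<Rightarrow> 'a rel" where
  "least_card P = card_of (SOME A. P A \<and> (\<forall>B. P B \<longrightarrow> |A| \<le>o |B| ))"

definition almost_disjointness_number :: "nat set rel" where
  "almost_disjointness_number = least_card MAD_family"

definition splitting_number :: "nat set rel" where
  "splitting_number = least_card splitting_family"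

lemma least_card_props:
  assumes "P A"
  shows "\<exists>B. P B \<and> least_card P = |B|" and "\<And>B. P B \<Longrightarrow> least_card P \<le>o |B|"
proof -
  let ?R = "card_of ` Collect P"
  have "\<exists>r\<in>?R. \<forall>r'\<in>?R. r \<le>o r'"
    using assms by (intro exists_minim_Card_order) (auto intro: card_of_Card_order)
  then have "\<exists>A. P A \<and> (\<forall>B. P B \<longrightarrow> |A| \<le>o |B| )"
    by auto
  note * = someI_ex[OF this]
  show "\<exists>B. P B \<and> least_card P = |B|" "\<And>B. P B \<Longrightarrow> least_card P \<le>o |B|"
    unfolding least_card_def using * by blast+
qed

lemma almost_disjoint_family_exists: "\<exists>A. almost_disjoint_family A"
proof -
  obtain C :: "nat \<Rightarrow> nat set"
    where disj: "pairwise (\<lambda>i j. disjnt (C i) (C j)) UNIV" and inf: "\<And>i. infinite (C i)"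
    using infinite_infinite_partition[of "UNIV :: nat set"] by auto
  have dis: "C i \<inter> C j = {}" if "i \<noteq> j" for i j
    using disj that by (auto simp: pairwise_def disjnt_def)
  have "inj C"
    using dis inf by (metis finite.emptyI inf.idem injI)
  then have "infinite (range C)"
    by (rule range_inj_infinite)
  moreover have "finite (a \<inter> b)" if "a \<in> range C" "b \<in> range C" "a \<noteq> b" for a b
    using that dis by (metis finite.emptyI imageE)
  ultimately have "almost_disjoint_family (range C)"
    using inf by (auto simp: almost_disjoint_family_def pairwise_def)
  then show ?thesis ..
qed

lemma MAD_family_exists: "\<exists>A. MAD_family A"
proof -
  obtain A0 where A0: "almost_disjoint_family A0"
    using almost_disjoint_family_exists by blast
  have "\<exists>M\<in>Collect almost_disjoint_family. \<forall>X\<in>Collect almost_disjoint_family. M \<subseteq> X \<longrightarrow> X = M"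
  proof (rule subset_Zorn_nonempty)
    show "Collect almost_disjoint_family \<noteq> {}"
      using A0 by auto
  next
    fix K assume "K \<noteq> {}" and K: "subset.chain (Collect almost_disjoint_family) K"
    then obtain A1 where A1: "A1 \<in> K" by auto
    have ad: "\<And>A. A \<in> K \<Longrightarrow> almost_disjoint_family A"
      using K by (auto simp: subset_chain_def)
    have "infinite (\<Union>K)"
      using A1 ad[OF A1] by (meson Union_upper almost_disjoint_family_def finite_subset)
    moreover have "\<forall>a\<in>\<Union>K. infinite a"
      using ad by (auto simp: almost_disjoint_family_def)
    moreover have "finite (a \<inter> b)" if ab: "a \<in> \<Union>K" "b \<in> \<Union>K" "a \<noteq> b" for a b
    proof -
      obtain A B where AB: "A \<in> K" "a \<in> A" "B \<in> K" "b \<in> B" using ab by auto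
      have "A \<subseteq> B \<or> B \<subseteq> A"
        using K AB by (auto simp: subset_chain_def)
      then have "\<exists>D\<in>K. a \<in> D \<and> b \<in> D"
        using AB by auto
      then show ?thesis
        using ad \<open>a \<noteq> b\<close> unfolding almost_disjoint_family_def pairwise_def by blast
    qed
    ultimately show "\<Union>K \<in> Collect almost_disjoint_family"
      by (simp add: almost_disjoint_family_def pairwise_def)
  qed
  then show ?thesis
    unfolding MAD_family_def by blast
qed

lemma splitting_family_exists: "\<exists>S. splitting_family S"
proof
  have "\<exists>s. infinite s \<and> infinite (X \<inter> s) \<and> infinite (X - s)"
    if X: "infinite X" for X :: "nat set"
  proof -
    obtain C :: "nat \<Rightarrow> nat set"
      where disj: "pairwise (\<lambda>i j. disjnt (C i) (C j)) UNIV"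
        and sub: "(\<Union>i. C i) \<subseteq> X" and inf: "\<And>i. infinite (C i)"
      using infinite_infinite_partition[OF X] by blast
    have "C 0 \<inter> C 1 = {}"
      using disj by (auto simp: pairwise_def disjnt_def)
    then have "C 1 \<subseteq> X - C 0" "X \<inter> C 0 = C 0"
      using sub by auto
    then show ?thesis
      using inf by (metis finite_subset)
  qed
  then show "splitting_family {s. infinite s}"
    by (auto simp: splitting_family_def)
qed


section \<open>The space Psi\<close>

definition Psi_base :: "nat set set \<Rightarrow> (nat + nat set) set set" where
  "Psi_base A =
     {{Inl n} |n. True} \<union> {insert (Inr a) (Inl ` (a - F)) |a F. a \<in> A \<and> finite F}"

definition Psi :: "nat set set \<Rightarrow> (nat + nat set) topology" where
  "Psi A = topology_generated_by (Psi_base A)"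

lemma topspace_Psi: "topspace (Psi A) = range Inl \<union> Inr ` A"
proof -
  have "\<Union>(Psi_base A) \<subseteq> range Inl \<union> Inr ` A"
    unfolding Psi_base_def by auto
  moreover have "{Inl n} \<in> Psi_base A" for n
    unfolding Psi_base_def by auto
  moreover have "insert (Inr a) (Inl ` (a - {})) \<in> Psi_base A" if "a \<in> A" for a
    unfolding Psi_base_def using that by blast
  ultimately show ?thesis
    unfolding Psi_def topology_generated_by_topspace by blast
qed

lemma openin_Psi_iff: "openin (Psi A) U \<longleftrightarrow> (arbitrary union_of (\<lambda>B. B \<in> Psi_base A)) U"
proof -
  have base: "\<exists>V. V \<in> Psi_base A \<and> x \<in> V \<and> V \<subseteq> U"
    if "generate_topology_on (Psi_base A) U" "x \<in> U" for U x
    using that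
  proof (induction arbitrary: x)
    case (Int S T)
    obtain V W where V: "V \<in> Psi_base A" "x \<in> V" "V \<subseteq> S" and W: "W \<in> Psi_base A" "x \<in> W" "W \<subseteq> T"
      using Int.IH(1)[of x] Int.IH(2)[of x] Int.prems by auto
    show ?case
    proof (cases x)
      case (Inl n)
      have "{Inl n} \<in> Psi_base A" unfolding Psi_base_def by auto
      then show ?thesis using Inl Int.prems by blast
    next
      case (Inr a)
      obtain F where F: "V = insert (Inr a) (Inl ` (a - F))" "a \<in> A" "finite F"
        using V(1,2) Inr unfolding Psi_base_def by auto
      obtain G where G: "W = insert (Inr a) (Inl ` (a - G))" "finite G"
        using W(1,2) Inr unfolding Psi_base_def by auto
      let ?N = "insert (Inr a) (Inl ` (a - (F \<union> G)))"
      have "?N \<in> Psi_base A"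
        using F G unfolding Psi_base_def by blast
      moreover have "?N \<subseteq> V" "?N \<subseteq> W"
        using F G by auto
      ultimately show ?thesis
        using V W Inr by blast
    qed
  next
    case (UN K)
    then show ?case by (meson UnionE Union_upper subset_trans)
  qed auto
  have "openin (Psi A) = arbitrary union_of (\<lambda>B. B \<in> Psi_base A)"
    unfolding openin_topology_base_unique Psi_def
    using base by (auto simp: openin_topology_generated_by_iff generate_topology_on.Basis)
  then show ?thesis by simp
qed

lemma t1_space_Psi: "t1_space (Psi A)"
  unfolding t1_space_def
proof (intro ballI impI)
  fix x y assume x: "x \<in> topspace (Psi A)" and "x \<noteq> y"
  have op: "openin (Psi A) B" if "B \<in> Psi_base A" for B
    using that unfolding Psi_def by (rule topology_generated_by_Basis)
  show "\<exists>U. openin (Psi A) U \<and> x \<in> U \<and> y \<notin> U"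
  proof (cases x)
    case (Inl n)
    have "{Inl n} \<in> Psi_base A" unfolding Psi_base_def by auto
    then show ?thesis using op Inl \<open>x \<noteq> y\<close> by blast
  next
    case (Inr a)
    let ?N = "insert (Inr a) (Inl ` (a - {n. y = Inl n}))"
    have "finite {n. y = Inl n}" by (cases y) auto
    then have "?N \<in> Psi_base A"
      using x Inr unfolding topspace_Psi Psi_base_def by blast
    moreover have "y \<notin> ?N" using Inr \<open>x \<noteq> y\<close> by auto
    ultimately show ?thesis using op Inr by blast
  qed
qed


section \<open>Hyperspaces and pseudocompactness\<close>

definition closed_subsets :: "'a topology \<Rightarrow> 'a set set" where
  "closed_subsets X = {F. closedin X F \<and> F \<noteq> {}}"

definition Vietoris :: "'a topology \<Rightarrow> 'a set topology" where
  "Vietoris X = topology_generated_by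
     ({{F \<in> closed_subsets X. F \<subseteq> U} |U. openin X U} \<union>
      {{F \<in> closed_subsets X. F \<inter> U \<noteq> {}} |U. openin X U})"

lemma topspace_Vietoris: "topspace (Vietoris X) = closed_subsets X"
proof -
  have "closed_subsets X = {F \<in> closed_subsets X. F \<subseteq> topspace X}"
    unfolding closed_subsets_def using closedin_subset by blast
  then show ?thesis
    unfolding Vietoris_def topology_generated_by_topspace using openin_topspace[of X] by blast
qed

definition pseudocompact_space :: "'a topology \<Rightarrow> bool" where
  "pseudocompact_space X \<longleftrightarrow>
     (\<forall>f. continuous_map X euclideanreal f \<longrightarrow> bounded (f ` topspace X))"

definition pseudocompact_family :: "nat set set \<Rightarrow> bool" where
  "pseudocompact_family A \<longleftrightarrow> pseudocompact_space (Vietoris (Psi A))"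

end

theory Submission
  imports Defs
begin

text \<open>
  A MAD family \<open>A\<close> of least cardinality witnesses both claims.

  It is fin-intersecting because it is small (\<open>fin_intersecting_if_small\<close>). For a fin sequence
  \<open>C\<close>, every \<open>a \<in> A\<close> gives the set \<open>T a\<close> of those \<open>n\<close> for which \<open>a\<close> meets \<open>C n\<close>. There are fewer
  of these sets than the splitting number, so they do not form a splitting family: some infinite
  \<open>I\<close> is split by none of them. The traces \<open>I \<inter> T a\<close> are then finite or cofinite in \<open>I\<close>, and
  finitely many cofinite subsets of \<open>I\<close> have infinite intersection.

  Every fin-intersecting MAD family is pseudocompact
  (\<open>pseudocompact_family_if_fin_intersecting\<close>). Finite subsets of \<open>\<omega>\<close> are dense in the hyperspace,
  so an unbounded continuous \<open>f\<close> takes values of absolute value above \<open>n\<close> at finite sets \<open>G n\<close>; such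
  a sequence cannot cluster anywhere, as \<open>f\<close> is bounded near each point. It remains to find a
  cluster point for every sequence of nonempty finite sets. By compactness of the Cantor space, a
  subsequence of \<open>G\<close> converges pointwise to some \<open>R \<subseteq> \<omega>\<close>, and thinning it out further makes its
  terms initial segments of \<open>R\<close> together with pairwise disjoint remainders \<open>C j\<close>
  (\<open>subsequence_splits_into_disjoint_tails\<close>). The initial segments converge to the closure of \<open>R\<close>.
  For the remainders, let \<open>I\<close> be as in the definition of fin-intersecting and let \<open>L\<close> consist of the
  \<open>a \<in> A\<close> that meet \<open>C j\<close> for infinitely many \<open>j \<in> I\<close>. Maximality of \<open>A\<close> puts almost all \<open>C j\<close> with
  \<open>j \<in> I\<close> inside any given open set around \<open>L\<close>, and centeredness makes infinitely many of them meet
  any finitely many open sets that meet \<open>L\<close>. The union of \<open>L\<close> and the closure of \<open>R\<close> is therefore a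
  cluster point.
\<close>

section \<open>Small almost disjoint families are fin-intersecting\<close>

text \<open>Otherwise \<open>D\<close> itself could be added to the family.\<close>

lemma MAD_family_infinite_Int:
  assumes "MAD_family A" and "infinite D"
  obtains a where "a \<in> A" and "infinite (a \<inter> D)"
proof -
  have "\<exists>a\<in>A. infinite (a \<inter> D)"
  proof (rule ccontr)
    assume *: "\<not> ?thesis"
    have ad: "almost_disjoint_family A"
      using assms(1) by (simp add: MAD_family_def)
    have "D \<notin> A"
      using * assms(2) by auto
    moreover have "almost_disjoint_family (insert D A)"
      using ad * assms(2) unfolding almost_disjoint_family_def pairwise_insert
      by (auto simp: Int_commute)
    ultimately show False
      using assms(1) unfolding MAD_family_def by blast
  qed
  then show thesis
    using that by blast
qed

lemma not_splitting_family_if_small: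
  assumes "|S| <o splitting_number"
  shows "\<not> splitting_family S"
  using least_card_props(2)[of splitting_family S] assms not_ordLess_ordLeq
  unfolding splitting_number_def by blast

lemma fin_intersecting_if_small:
  assumes "|A| <o splitting_number"
  shows "fin_intersecting A"
  unfolding fin_intersecting_def
proof (intro allI impI)
  fix C :: "nat \<Rightarrow> nat set"
  define T where "T a = {n. a \<inter> C n \<noteq> {}}" for a
  have "|{t \<in> T ` A. infinite t}| \<le>o |T ` A|"
    by (rule card_of_mono1) auto
  also have "|T ` A| \<le>o |A|"
    by (rule card_of_image)
  finally have "\<not> splitting_family {t \<in> T ` A. infinite t}"
    using assms by (intro not_splitting_family_if_small) (rule ordLeq_ordLess_trans)
  then obtain I where I: "infinite I"
    and unsplit: "\<And>t. t \<in> T ` A \<Longrightarrow> infinite t \<Longrightarrow> finite (I \<inter> t) \<or> finite (I - t)"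
    unfolding splitting_family_def by blast
  have trace: "{n \<in> I. a \<inter> C n \<noteq> {}} = I \<inter> T a" for a
    by (auto simp: T_def)
  \<comment> \<open>As \<open>T a\<close> does not split \<open>I\<close>, an infinite trace is cofinite in \<open>I\<close>.\<close>
  have cofin: "finite (I - t) \<and> t \<subseteq> I" if t: "t \<in> (\<lambda>a. I \<inter> T a) ` A - Fpow I" for t
  proof -
    obtain a where a: "a \<in> A" "t = I \<inter> T a" "infinite (I \<inter> T a)"
      using t by (auto simp: Fpow_def)
    then have "finite (I - T a)"
      using unsplit[of "T a"] by auto
    then show ?thesis
      using a(2) by (simp add: Diff_Int)
  qed
  have "centered ((\<lambda>a. I \<inter> T a) ` A - Fpow I)"
    unfolding centered_def
  proof (intro allI impI, elim conjE)
    fix F assume F: "F \<subseteq> (\<lambda>a. I \<inter> T a) ` A - Fpow I" "finite F" "F \<noteq> {}"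
    have "finite (\<Union>t\<in>F. I - t)"
      using F cofin by blast
    moreover have "I = \<Inter>F \<union> (\<Union>t\<in>F. I - t)"
      using F cofin by blast
    ultimately show "infinite (\<Inter>F)"
      using I by (metis finite_UnI)
  qed
  then show "\<exists>I. infinite I \<and> centered ((\<lambda>a. {n \<in> I. a \<inter> C n \<noteq> {}}) ` A - Fpow I)"
    using I trace by auto
qed


section \<open>Open sets of Psi and neighbourhoods in the hyperspace\<close>

text \<open>
  This replaces the generating base by a test at each point: natural numbers impose no condition, and
  the basic neighbourhoods of \<open>a\<close> are \<open>a\<close> together with cofinite parts of the set \<open>a\<close>.
\<close>

lemma openin_Psi_iff_almost_contains:
  "openin (Psi A) U \<longleftrightarrow>
     U \<subseteq> range Inl \<union> Inr ` A \<and> (\<forall>a. Inr a \<in> U \<longrightarrow> finite {n \<in> a. Inl n \<notin> U})"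
proof (intro iffI conjI allI impI)
  assume U: "openin (Psi A) U"
  then show "U \<subseteq> range Inl \<union> Inr ` A"
    using openin_subset topspace_Psi by blast
  fix a assume a: "Inr a \<in> U"
  then obtain B where B: "B \<in> Psi_base A" "Inr a \<in> B" "B \<subseteq> U"
    using U unfolding openin_Psi_iff union_of_def arbitrary_def by auto
  then obtain F where F: "B = insert (Inr a) (Inl ` (a - F))" "finite F"
    unfolding Psi_base_def by auto
  then have "{n \<in> a. Inl n \<notin> U} \<subseteq> F"
    using B by auto
  then show "finite {n \<in> a. Inl n \<notin> U}"
    using F(2) finite_subset by blast
next
  assume U: "U \<subseteq> range Inl \<union> Inr ` A \<and> (\<forall>a. Inr a \<in> U \<longrightarrow> finite {n \<in> a. Inl n \<notin> U})"
  show "openin (Psi A) U"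
  proof (subst openin_subopen, intro ballI)
    fix x assume x: "x \<in> U"
    have "\<exists>B\<in>Psi_base A. x \<in> B \<and> B \<subseteq> U"
    proof (cases x)
      case (Inl n)
      have "{Inl n} \<in> Psi_base A" unfolding Psi_base_def by auto
      then show ?thesis using Inl x by blast
    next
      case (Inr a)
      let ?B = "insert (Inr a) (Inl ` (a - {n \<in> a. Inl n \<notin> U}))"
      have "?B \<in> Psi_base A"
        using U x Inr unfolding Psi_base_def by blast
      moreover have "?B \<subseteq> U" "x \<in> ?B"
        using x Inr by auto
      ultimately show ?thesis by (intro bexI[of _ ?B] conjI)
    qed
    then obtain B where "B \<in> Psi_base A" "x \<in> B" "B \<subseteq> U"
      by blast
    then show "\<exists>T. openin (Psi A) T \<and> x \<in> T \<and> T \<subseteq> U"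
      unfolding Psi_def by (intro exI[of _ B] conjI topology_generated_by_Basis)
  qed
qed

lemma closedin_Psi_Inr_image:
  assumes "B \<subseteq> A"
  shows "closedin (Psi A) (Inr ` B)"
proof -
  have no_points: "{n \<in> a. Inl n \<in> Inr ` B} = {}" for a :: "nat set"
    by blast
  show ?thesis
    using assms unfolding closedin_def topspace_Psi openin_Psi_iff_almost_contains
    by (auto simp: no_points)
qed

lemma openin_Psi_contains_Inl:
  assumes "\<And>a. a \<in> A \<Longrightarrow> infinite a" and U: "openin (Psi A) U" and "U \<noteq> {}"
  obtains n where "Inl n \<in> U"
proof -
  obtain x where x: "x \<in> U" using \<open>U \<noteq> {}\<close> by blast
  show thesis
  proof (cases x)
    case (Inl n)
    then show thesis using that x by blast
  next
    case (Inr a)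
    then have "infinite a" "finite {n \<in> a. Inl n \<notin> U}"
      using x U assms(1) unfolding openin_Psi_iff_almost_contains by auto
    then have "infinite (a - {n \<in> a. Inl n \<notin> U})"
      by simp
    then have "a - {n \<in> a. Inl n \<notin> U} \<noteq> {}"
      by (rule infinite_imp_nonempty)
    then show thesis
      using that by auto
  qed
qed

text \<open>
  The set usually written \<open>\<langle>V\<^sub>1, \<dots>, V\<^sub>n\<rangle>\<close>, except that the bounding set \<open>U\<close> need not be the union of
  the sets to be met; the intersection of two boxes is then visibly a box.
\<close>

definition Vietoris_box :: "'a topology \<Rightarrow> 'a set \<Rightarrow> 'a set set \<Rightarrow> 'a set set" where
  "Vietoris_box X U \<V> = {F \<in> closed_subsets X. F \<subseteq> U \<and> (\<forall>V\<in>\<V>. F \<inter> V \<noteq> {})}"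

lemma Vietoris_box_neighbourhood:
  assumes "openin (Vietoris X) W" and "P \<in> W"
  obtains U \<V> where "openin X U" and "finite \<V>" and "\<forall>V\<in>\<V>. openin X V"
    and "P \<in> Vietoris_box X U \<V>" and "Vietoris_box X U \<V> \<subseteq> W"
proof -
  let ?base = "{{F \<in> closed_subsets X. F \<subseteq> U} |U. openin X U} \<union>
      {{F \<in> closed_subsets X. F \<inter> U \<noteq> {}} |U. openin X U}"
  have PX: "P \<in> closed_subsets X"
    using assms openin_subset[of "Vietoris X" W] unfolding topspace_Vietoris by blast
  then have sub: "P \<subseteq> topspace X"
    unfolding closed_subsets_def using closedin_subset by blast
  have "generate_topology_on ?base W"
    using assms(1) unfolding Vietoris_def openin_topology_generated_by_iff .
  then have "\<exists>U \<V>. openin X U \<and> finite \<V> \<and> (\<forall>V\<in>\<V>. openin X V) \<and>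
    P \<in> Vietoris_box X U \<V> \<and> Vietoris_box X U \<V> \<subseteq> W"
    using assms(2)
  proof induction
    case Empty
    then show ?case by simp
  next
    case (Int S T)
    have PS: "P \<in> S" and PT: "P \<in> T"
      using Int.prems by auto
    obtain U \<V> where S: "openin X U" "finite \<V>" "\<forall>V\<in>\<V>. openin X V"
      "P \<in> Vietoris_box X U \<V>" "Vietoris_box X U \<V> \<subseteq> S"
      using Int.IH(1)[OF PS] by (elim exE conjE)
    obtain U' \<V>' where T: "openin X U'" "finite \<V>'" "\<forall>V\<in>\<V>'. openin X V"
      "P \<in> Vietoris_box X U' \<V>'" "Vietoris_box X U' \<V>' \<subseteq> T"
      using Int.IH(2)[OF PT] by (elim exE conjE)
    have box: "Vietoris_box X (U \<inter> U') (\<V> \<union> \<V>') = Vietoris_box X U \<V> \<inter> Vietoris_box X U' \<V>'"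
      unfolding Vietoris_box_def by blast
    show ?case
      by (rule exI[of _ "U \<inter> U'"], rule exI[of _ "\<V> \<union> \<V>'"]) (use S T box in auto)
  next
    case (UN K)
    then obtain k where k: "k \<in> K" "P \<in> k" by blast
    obtain U \<V> where "openin X U" "finite \<V>" "\<forall>V\<in>\<V>. openin X V"
      "P \<in> Vietoris_box X U \<V>" "Vietoris_box X U \<V> \<subseteq> k"
      using UN.IH[OF k] by (elim exE conjE)
    then show ?case
      using k(1) by (intro exI[of _ U] exI[of _ \<V>] conjI) (assumption+, blast)
  next
    case (Basis s)
    then consider U where "openin X U" "s = {F \<in> closed_subsets X. F \<subseteq> U}"
      | V where "openin X V" "s = {F \<in> closed_subsets X. F \<inter> V \<noteq> {}}"
      by blast
    then show ?case
    proof cases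
      case 1
      show ?thesis
        by (rule exI[of _ U], rule exI[of _ "{}"])
          (use 1 Basis in \<open>auto simp: Vietoris_box_def\<close>)
    next
      case 2
      show ?thesis
        by (rule exI[of _ "topspace X"], rule exI[of _ "{V}"])
          (use 2 Basis PX sub in \<open>auto simp: Vietoris_box_def\<close>)
    qed
  qed
  then show thesis
    by (elim exE conjE) (rule that)
qed

lemma Inl_image_closed_subset:
  assumes "finite F" and "F \<noteq> {}"
  shows "Inl ` F \<in> closed_subsets (Psi A)"
  unfolding closed_subsets_def
  using assms t1_space_Psi[of A] unfolding t1_space_closedin_finite
  by (auto simp: topspace_Psi image_subset_iff)

text \<open>
  As \<open>\<omega>\<close> is dense in \<open>\<Psi>\<close>, a point of \<open>\<omega>\<close> can be chosen in each of the finitely many open sets that a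
  member of a box must meet.
\<close>

lemma finite_sets_dense_in_Vietoris_Psi:
  assumes A: "\<And>a. a \<in> A \<Longrightarrow> infinite a" and W: "openin (Vietoris (Psi A)) W" "P \<in> W"
  obtains F where "finite F" and "F \<noteq> {}" and "Inl ` F \<in> W"
proof -
  obtain U \<V> where U: "openin (Psi A) U" "finite \<V>" and V: "\<forall>V\<in>\<V>. openin (Psi A) V"
    and P: "P \<in> Vietoris_box (Psi A) U \<V>" and W': "Vietoris_box (Psi A) U \<V> \<subseteq> W"
    using W by (rule Vietoris_box_neighbourhood)
  have P: "P \<noteq> {}" "P \<subseteq> U" "\<forall>V\<in>\<V>. P \<inter> V \<noteq> {}"
    using P by (auto simp: Vietoris_box_def closed_subsets_def)
  \<comment> \<open>Including \<open>U\<close> yields a point, hence a nonempty set, even if \<open>\<V>\<close> is empty.\<close>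
  have "\<exists>n. Inl n \<in> U \<inter> V" if "V \<in> insert U \<V>" for V
  proof -
    have "openin (Psi A) (U \<inter> V)"
      using that U V by auto
    moreover have "U \<inter> V \<noteq> {}"
      using that P by blast
    ultimately show ?thesis
      using openin_Psi_contains_Inl[OF A] by metis
  qed
  then obtain p where p: "\<And>V. V \<in> insert U \<V> \<Longrightarrow> Inl (p V) \<in> U \<inter> V"
    by metis
  let ?F = "p ` insert U \<V>"
  have "finite ?F" "?F \<noteq> {}"
    using U by auto
  moreover have "Inl ` ?F \<subseteq> U" "\<forall>V\<in>\<V>. Inl ` ?F \<inter> V \<noteq> {}"
    using p by auto
  moreover have "Inl ` ?F \<in> W"
    using calculation Inl_image_closed_subset W' unfolding Vietoris_box_def by blast
  ultimately show thesis
    using that by blast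
qed


section \<open>Cluster points of sequences of finite sets\<close>

lemma finite_meets_disjoint_family:
  assumes "disjoint_family C" and "finite F"
  shows "finite {n. C n \<inter> F \<noteq> {}}"
proof -
  have "finite {n. x \<in> C n}" for x
  proof (cases "\<exists>m. x \<in> C m")
    case True
    then obtain m where "x \<in> C m" by blast
    then have "{n. x \<in> C n} \<subseteq> {m}"
      using assms(1) unfolding disjoint_family_on_def by blast
    then show ?thesis by (rule finite_subset) simp
  qed auto
  then have "finite (\<Union>x\<in>F. {n. x \<in> C n})"
    using assms(2) by blast
  moreover have "{n. C n \<inter> F \<noteq> {}} = (\<Union>x\<in>F. {n. x \<in> C n})"
    by auto
  ultimately show ?thesis by simp
qed

definition hit_infinitely_often where
  "hit_infinitely_often A C I = {a \<in> A. infinite {n \<in> I. a \<inter> C n \<noteq> {}}}"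

text \<open>
  If infinitely many \<open>C n\<close> left \<open>U\<close>, the points outside \<open>U\<close> would form an infinite set \<open>D\<close>, and by
  maximality some \<open>a\<close> would meet \<open>D\<close> infinitely often. Since the \<open>C n\<close> are finite, \<open>a\<close> would meet
  infinitely many of them, so it would lie in \<open>U\<close>, although infinitely many of its points do not.
\<close>

lemma eventually_in_open_superset:
  assumes MAD: "MAD_family A" and C: "disjoint_family C" "\<And>n. finite (C n)"
    and U: "openin (Psi A) U" "Inr ` hit_infinitely_often A C I \<subseteq> U"
  shows "finite {n \<in> I. \<not> Inl ` C n \<subseteq> U}"
proof (rule ccontr)
  define J where "J = {n \<in> I. \<not> Inl ` C n \<subseteq> U}"
  define D where "D = {x. \<exists>n\<in>J. x \<in> C n \<and> Inl x \<notin> U}"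
  assume "infinite {n \<in> I. \<not> Inl ` C n \<subseteq> U}"
  then have J: "infinite J" by (simp add: J_def)
  have "infinite D"
  proof
    assume "finite D"
    then have "finite {n. C n \<inter> D \<noteq> {}}"
      by (rule finite_meets_disjoint_family[OF C(1)])
    moreover have "J \<subseteq> {n. C n \<inter> D \<noteq> {}}"
      unfolding D_def by (auto simp: J_def)
    ultimately show False using J finite_subset by blast
  qed
  then obtain a where a: "a \<in> A" "infinite (a \<inter> D)"
    using MAD_family_infinite_Int[OF MAD] by metis
  have "a \<inter> D \<subseteq> (\<Union>n\<in>{n \<in> I. a \<inter> C n \<noteq> {}}. C n)"
    unfolding D_def J_def by auto
  then have "infinite {n \<in> I. a \<inter> C n \<noteq> {}}"
    using a(2) C(2) by (meson finite_UN_I finite_subset)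
  then have "Inr a \<in> U"
    using U(2) a(1) unfolding hit_infinitely_often_def by blast
  then have "finite {n \<in> a. Inl n \<notin> U}"
    using U(1) unfolding openin_Psi_iff_almost_contains by blast
  moreover have "a \<inter> D \<subseteq> {n \<in> a. Inl n \<notin> U}"
    unfolding D_def by auto
  ultimately show False using a(2) finite_subset by blast
qed

text \<open>
  Each \<open>V\<close> contains almost all of some \<open>a\<close> that is hit infinitely often. Centeredness supplies
  infinitely many \<open>n\<close> for which \<open>C n\<close> meets all these finitely many \<open>a\<close>; by disjointness, only
  finitely many of the \<open>C n\<close> contain one of the finitely many missing points.
\<close>

lemma infinitely_often_meets_open_sets:
  assumes C: "disjoint_family C" and I: "infinite I"
    and cent: "centered ((\<lambda>a. {n \<in> I. a \<inter> C n \<noteq> {}}) ` A - Fpow I)"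
    and V: "finite \<V>" "\<And>V. V \<in> \<V> \<Longrightarrow> openin (Psi A) V \<and> Inr ` hit_infinitely_often A C I \<inter> V \<noteq> {}"
  shows "infinite {n \<in> I. \<forall>V\<in>\<V>. Inl ` C n \<inter> V \<noteq> {}}"
proof (cases "\<V> = {}")
  case True
  then show ?thesis using I by simp
next
  case False
  let ?t = "\<lambda>a. {n \<in> I. a \<inter> C n \<noteq> {}}"
  have "\<exists>a. a \<in> hit_infinitely_often A C I \<and> Inr a \<in> V" if "V \<in> \<V>" for V
    using V(2)[OF that] by auto
  then have "\<forall>V\<in>\<V>. \<exists>a. a \<in> hit_infinitely_often A C I \<and> Inr a \<in> V"
    by blast
  from bchoice[OF this]
  obtain p where p: "\<And>V. V \<in> \<V> \<Longrightarrow> p V \<in> hit_infinitely_often A C I \<and> Inr (p V) \<in> V"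
    by blast
  define F where "F V = {n \<in> p V. Inl n \<notin> V}" for V
  have F: "finite (F V)" if "V \<in> \<V>" for V
    using V(2)[OF that] p[OF that] by (simp add: F_def openin_Psi_iff_almost_contains)
  let ?S = "(\<lambda>V. ?t (p V)) ` \<V>"
  let ?E = "\<Union>V\<in>\<V>. {n. C n \<inter> F V \<noteq> {}}"
  have "?t (p V) \<in> ?t ` A - Fpow I" if "V \<in> \<V>" for V
    using p[OF that] unfolding hit_infinitely_often_def Fpow_def by auto
  then have "?S \<subseteq> ?t ` A - Fpow I" by blast
  moreover have "finite ?S" "?S \<noteq> {}"
    using V(1) False by auto
  ultimately have "infinite (\<Inter>?S)"
    using cent unfolding centered_def by simp
  moreover have "finite ?E"
    using V(1) F finite_meets_disjoint_family[OF C] by blast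
  ultimately have "infinite (\<Inter>?S - ?E)"
    by simp
  moreover have "\<Inter>?S - ?E \<subseteq> {n \<in> I. \<forall>V\<in>\<V>. Inl ` C n \<inter> V \<noteq> {}}"
  proof
    fix n assume n: "n \<in> \<Inter>?S - ?E"
    have "Inl ` C n \<inter> V \<noteq> {}" if V: "V \<in> \<V>" for V
    proof -
      have "p V \<inter> C n \<noteq> {}" "C n \<inter> F V = {}"
        using n V by auto
      then show ?thesis
        unfolding F_def by blast
    qed
    moreover have "n \<in> I"
      using n False by auto
    ultimately show "n \<in> {n \<in> I. \<forall>V\<in>\<V>. Inl ` C n \<inter> V \<noteq> {}}"
      by simp
  qed
  ultimately show ?thesis
    by (rule infinite_super[rotated])
qed

text \<open>
  The two conclusions on \<open>U\<close> and \<open>\<V>\<close> say that the \<open>C n\<close> with \<open>n \<in> I\<close> cluster at \<open>L\<close>. Empty terms, and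
  an empty \<open>L\<close>, are admitted because the sets \<open>C n\<close> will be remainders of larger sets. If infinitely
  many terms are empty, these alone cluster at the empty set; otherwise a tail of \<open>C\<close> is a fin
  sequence.
\<close>

lemma disjoint_finite_sets_cluster:
  assumes MAD: "MAD_family A" and fi: "fin_intersecting A"
    and C: "disjoint_family C" "\<And>n :: nat. finite (C n)"
  obtains L I where "closedin (Psi A) L" and "infinite I"
    and "\<forall>U. openin (Psi A) U \<longrightarrow> L \<subseteq> U \<longrightarrow> finite {n \<in> I. \<not> Inl ` C n \<subseteq> U}"
    and "\<forall>\<V>. finite \<V> \<longrightarrow> (\<forall>V\<in>\<V>. openin (Psi A) V \<and> L \<inter> V \<noteq> {}) \<longrightarrow>
           infinite {n \<in> I. \<forall>V\<in>\<V>. Inl ` C n \<inter> V \<noteq> {}}"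
proof (cases "finite {n. C n = {}}")
  case False
  have "\<V> = {}" if "\<forall>V\<in>\<V>. openin (Psi A) V \<and> {} \<inter> V \<noteq> {}" for \<V>
    using that by blast
  moreover have "{n \<in> {n. C n = {}}. \<not> Inl ` C n \<subseteq> U} = {}" for U :: "(nat + nat set) set"
    by auto
  ultimately show thesis
    using False by (intro that[of "{}" "{n. C n = {}}"]) (auto simp del: mem_Collect_eq Collect_empty_eq)
next
  case True
  then obtain N where N: "\<And>n. C n = {} \<Longrightarrow> n < N"
    unfolding finite_nat_set_iff_bounded by auto
  have dis: "disjoint_family (\<lambda>n. C (n + N))"
    using C(1) unfolding disjoint_family_on_def by simp
  moreover have "C (n + N) \<noteq> {}" for n
    using N[of "n + N"] by auto
  ultimately have "fin_sequence (\<lambda>n. C (n + N))"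
    using C unfolding fin_sequence_def by simp
  then obtain I where I: "infinite I"
    and cent: "centered ((\<lambda>a. {n \<in> I. a \<inter> C (n + N) \<noteq> {}}) ` A - Fpow I)"
    using fi unfolding fin_intersecting_def by blast
  let ?s = "\<lambda>n. n + N"
  let ?L = "Inr ` hit_infinitely_often A (\<lambda>n. C (n + N)) I"
  have shift: "{n \<in> ?s ` I. Q n} = ?s ` {n \<in> I. Q (n + N)}" for Q
    by auto
  show thesis
  proof (rule that[of ?L "?s ` I"])
    show "closedin (Psi A) ?L"
      by (rule closedin_Psi_Inr_image) (auto simp: hit_infinitely_often_def)
    show "infinite (?s ` I)"
      using I by (simp add: finite_image_iff)
    show "\<forall>U. openin (Psi A) U \<longrightarrow> ?L \<subseteq> U \<longrightarrow> finite {n \<in> ?s ` I. \<not> Inl ` C n \<subseteq> U}"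
      using eventually_in_open_superset[OF MAD dis C(2)] unfolding shift by blast
    show "\<forall>\<V>. finite \<V> \<longrightarrow> (\<forall>V\<in>\<V>. openin (Psi A) V \<and> ?L \<inter> V \<noteq> {}) \<longrightarrow>
        infinite {n \<in> ?s ` I. \<forall>V\<in>\<V>. Inl ` C n \<inter> V \<noteq> {}}"
      using infinitely_often_meets_open_sets[OF dis I cent] unfolding shift
      by (simp add: finite_image_iff)
  qed
qed

text \<open>
  A \<open>\<Delta>\<close>-system argument with a possibly infinite root. The root \<open>R\<close> is a pointwise cluster point of the
  \<open>G n\<close>, built along an infinite branch of the binary tree: each initial segment \<open>S i\<close> is shared by
  infinitely many \<open>G n\<close>. The terms are then chosen so that each one agrees with \<open>R\<close> below a bound
  \<open>k j\<close> that exceeds all elements of the earlier ones.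
\<close>

lemma subsequence_splits_into_disjoint_tails:
  fixes G :: "nat \<Rightarrow> nat set"
  assumes G: "\<And>n. finite (G n)"
  obtains R m k C where "strict_mono (m :: nat \<Rightarrow> nat)" and "strict_mono (k :: nat \<Rightarrow> nat)"
    and "disjoint_family C" and "\<forall>j. G (m j) = (R \<inter> {..<k j}) \<union> C j"
proof -
  have "\<exists>S. \<forall>i. (S i \<subseteq> {..<i} \<and> infinite {n. G n \<inter> {..<i} = S i}) \<and> S (Suc i) \<inter> {..<i} = S i"
  proof (rule dependent_nat_choice)
    show "\<exists>S\<subseteq>{..<0}. infinite {n. G n \<inter> {..<0} = S}"
      by simp
  next
    fix S i assume S: "S \<subseteq> {..<i} \<and> infinite {n. G n \<inter> {..<i} = S}"
    have "{n. G n \<inter> {..<i} = S} \<subseteq>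
        {n. G n \<inter> {..<Suc i} = S} \<union> {n. G n \<inter> {..<Suc i} = insert i S}"
      by (auto simp: lessThan_Suc)
    then have "infinite {n. G n \<inter> {..<Suc i} = S} \<or> infinite {n. G n \<inter> {..<Suc i} = insert i S}"
      using S by (meson finite_UnI finite_subset)
    then show "\<exists>T. (T \<subseteq> {..<Suc i} \<and> infinite {n. G n \<inter> {..<Suc i} = T}) \<and> T \<inter> {..<i} = S"
    proof
      assume "infinite {n. G n \<inter> {..<Suc i} = S}"
      then show ?thesis using S by (intro exI[of _ S]) auto
    next
      assume "infinite {n. G n \<inter> {..<Suc i} = insert i S}"
      then show ?thesis using S by (intro exI[of _ "insert i S"]) auto
    qed
  qed
  then obtain S where S: "\<And>i. S i \<subseteq> {..<i}" "\<And>i. infinite {n. G n \<inter> {..<i} = S i}"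
    "\<And>i. S (Suc i) \<inter> {..<i} = S i" by blast
  define R where "R = (\<Union>i. S i)"
  have mono: "S (i + d) \<inter> {..<i} = S i" for i d
  proof (induction d)
    case 0
    then show ?case using S(1) by auto
  next
    case (Suc d)
    have "S (i + Suc d) \<inter> {..<i} = S (Suc (i + d)) \<inter> {..<i + d} \<inter> {..<i}"
      by auto
    then show ?case using S(3)[of "i + d"] Suc by simp
  qed
  have RS: "R \<inter> {..<i} = S i" for i
  proof
    show "S i \<subseteq> R \<inter> {..<i}" using S(1) by (auto simp: R_def)
    show "R \<inter> {..<i} \<subseteq> S i"
    proof
      fix x assume "x \<in> R \<inter> {..<i}"
      then obtain j where x: "x \<in> S j" "x < i" by (auto simp: R_def)
      show "x \<in> S i"
      proof (cases "i \<le> j")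
        case True
        then show ?thesis using mono[of i "j - i"] x by auto
      next
        case False
        then show ?thesis using mono[of j "i - j"] x by auto
      qed
    qed
  qed
  have agree: "infinite {n. G n \<inter> {..<i} = R \<inter> {..<i}}" for i
    using S(2) RS by simp
  \<comment> \<open>The pair \<open>p j\<close> consists of the index \<open>m j\<close> of the chosen term and the bound \<open>k j\<close>.\<close>
  have "\<exists>p. \<forall>j. (G (fst (p j)) \<inter> {..<snd (p j)} = R \<inter> {..<snd (p j)}) \<and>
      (fst (p j) < fst (p (Suc j)) \<and> snd (p j) < snd (p (Suc j)) \<and> G (fst (p j)) \<subseteq> {..<snd (p (Suc j))})"
  proof (rule dependent_nat_choice)
    show "\<exists>q. G (fst q) \<inter> {..<snd q} = R \<inter> {..<snd q}"
      by (rule exI[of _ "(0, 0)"]) simp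
  next
    fix q :: "nat \<times> nat" and j
    obtain b where b: "G (fst q) \<subseteq> {..<b}"
      using G[of "fst q"] finite_nat_iff_bounded by blast
    define k where "k = max b (Suc (snd q))"
    obtain n where "fst q < n" "G n \<inter> {..<k} = R \<inter> {..<k}"
      using agree[of k] unfolding infinite_nat_iff_unbounded by blast
    then show "\<exists>q'. (G (fst q') \<inter> {..<snd q'} = R \<inter> {..<snd q'}) \<and>
       (fst q < fst q' \<and> snd q < snd q' \<and> G (fst q) \<subseteq> {..<snd q'})"
      using b by (intro exI[of _ "(n, k)"]) (auto simp: k_def)
  qed
  then obtain p where p: "\<And>j. G (fst (p j)) \<inter> {..<snd (p j)} = R \<inter> {..<snd (p j)}"
      "\<And>j. fst (p j) < fst (p (Suc j))" "\<And>j. snd (p j) < snd (p (Suc j))"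
      "\<And>j. G (fst (p j)) \<subseteq> {..<snd (p (Suc j))}"
    by blast
  define C where "C j = G (fst (p j)) - {..<snd (p j)}" for j
  have k: "strict_mono (\<lambda>j. snd (p j))"
    using p(3) by (simp add: strict_mono_Suc_iff)
  have less: "C i \<inter> C j = {}" if "i < j" for i j
  proof -
    have "snd (p (Suc i)) \<le> snd (p j)"
      using strict_mono_less_eq[OF k, of "Suc i" j] that by simp
    then show ?thesis using p(4)[of i] unfolding C_def by auto
  qed
  show thesis
  proof (rule that[of "\<lambda>j. fst (p j)" "\<lambda>j. snd (p j)" C R])
    show "strict_mono (\<lambda>j. fst (p j))"
      using p(2) by (simp add: strict_mono_Suc_iff)
    show "disjoint_family C"
      unfolding disjoint_family_on_def using less by (metis Int_commute nat_neq_iff)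
    show "\<forall>j. G (fst (p j)) = R \<inter> {..<snd (p j)} \<union> C j"
    proof
      show "G (fst (p j)) = R \<inter> {..<snd (p j)} \<union> C j" for j
        using p(1)[of j] unfolding C_def by blast
    qed
  qed (use k in auto)
qed

text \<open>
  The cluster point is \<open>K \<union> L\<close> for the closure \<open>K\<close> of the root and the cluster set \<open>L\<close> of the remainders.
  An open set that meets \<open>K\<close> meets the root, hence its long initial segments, so it is met by almost
  all terms; this condition is therefore compatible with the merely frequent ones imposed by \<open>L\<close>.
\<close>

lemma finite_sets_cluster_in_Vietoris:
  assumes MAD: "MAD_family A" and fi: "fin_intersecting A"
    and G: "\<And>n :: nat. finite (G n)" "\<And>n. G n \<noteq> {}"
  obtains P where "P \<in> closed_subsets (Psi A)"
    and "\<forall>W. openin (Vietoris (Psi A)) W \<longrightarrow> P \<in> W \<longrightarrow> infinite {n. Inl ` G n \<in> W}"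
proof -
  obtain R m k C where m: "strict_mono (m :: nat \<Rightarrow> nat)" and k: "strict_mono (k :: nat \<Rightarrow> nat)"
    and C: "disjoint_family C" and split_all: "\<forall>j. G (m j) = (R \<inter> {..<k j}) \<union> C j"
    using G(1) by (rule subsequence_splits_into_disjoint_tails)
  note split = split_all[rule_format]
  have finC: "finite (C j)" for j
    using G(1)[of "m j"] split[of j] by simp
  obtain L I where L: "closedin (Psi A) L" and I: "infinite I"
    and up: "\<forall>U. openin (Psi A) U \<longrightarrow> L \<subseteq> U \<longrightarrow> finite {n \<in> I. \<not> Inl ` C n \<subseteq> U}"
    and low: "\<forall>\<V>. finite \<V> \<longrightarrow> (\<forall>V\<in>\<V>. openin (Psi A) V \<and> L \<inter> V \<noteq> {}) \<longrightarrow>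
           infinite {n \<in> I. \<forall>V\<in>\<V>. Inl ` C n \<inter> V \<noteq> {}}"
    using MAD fi C finC by (rule disjoint_finite_sets_cluster)
  define K where "K = Psi A closure_of (Inl ` R)"
  have RK: "Inl ` R \<subseteq> K"
    unfolding K_def by (rule closure_of_subset) (auto simp: topspace_Psi)
  have main: "infinite {j. Inl ` G (m j) \<subseteq> U \<and> (\<forall>V\<in>\<V>. Inl ` G (m j) \<inter> V \<noteq> {})}"
    if U: "openin (Psi A) U" "K \<union> L \<subseteq> U" and fV: "finite \<V>"
      and V: "\<And>V. V \<in> \<V> \<Longrightarrow> openin (Psi A) V \<and> (K \<union> L) \<inter> V \<noteq> {}" for U \<V>
  proof -
    let ?VL = "{V \<in> \<V>. L \<inter> V \<noteq> {}}" and ?VK = "{V \<in> \<V>. K \<inter> V \<noteq> {}}"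
    have "\<exists>r. r \<in> R \<and> Inl r \<in> V" if VK: "V \<in> ?VK" for V
    proof -
      have "openin (Psi A) V" "V \<inter> K \<noteq> {}"
        using VK V by auto
      then have "V \<inter> Inl ` R \<noteq> {}"
        unfolding K_def by (simp add: openin_Int_closure_of_eq_empty)
      then show ?thesis by auto
    qed
    then have "\<forall>V\<in>?VK. \<exists>r. r \<in> R \<and> Inl r \<in> V"
      by blast
    from bchoice[OF this] obtain r where r: "\<And>V. V \<in> ?VK \<Longrightarrow> r V \<in> R \<and> Inl (r V) \<in> V"
      by blast
    have "finite (r ` ?VK)" using fV by simp
    then obtain b where b: "r ` ?VK \<subseteq> {..<b}"
      using finite_nat_iff_bounded by blast
    let ?good = "{n \<in> I. \<forall>V\<in>?VL. Inl ` C n \<inter> V \<noteq> {}}"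
    let ?bad = "{n \<in> I. \<not> Inl ` C n \<subseteq> U} \<union> {..<b}"
    have "infinite ?good"
      using fV V by (intro low[rule_format]) auto
    moreover have "finite ?bad"
      using up U by auto
    ultimately have "infinite (?good - ?bad)" by simp
    moreover have "?good - ?bad \<subseteq> {j. Inl ` G (m j) \<subseteq> U \<and> (\<forall>V\<in>\<V>. Inl ` G (m j) \<inter> V \<noteq> {})}"
    proof
      fix j assume j: "j \<in> ?good - ?bad"
      have "Inl ` G (m j) \<subseteq> U"
        using j U(2) RK unfolding split by auto
      moreover have "Inl ` G (m j) \<inter> V \<noteq> {}" if VV: "V \<in> \<V>" for V
      proof (cases "L \<inter> V \<noteq> {}")
        case True
        then have "Inl ` C j \<inter> V \<noteq> {}" using j VV by auto
        then show ?thesis unfolding split by auto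
      next
        case False
        then have VK: "V \<in> ?VK" using V VV by auto
        have "b \<le> k j"
          using j strict_mono_imp_increasing[OF k, of j] by auto
        moreover have "r V < b"
          using imageI[OF VK, of r] b by blast
        ultimately have "r V \<in> R \<inter> {..<k j}"
          using r[OF VK] by simp
        then show ?thesis
          using r[OF VK] unfolding split by auto
      qed
      ultimately show "j \<in> {j. Inl ` G (m j) \<subseteq> U \<and> (\<forall>V\<in>\<V>. Inl ` G (m j) \<inter> V \<noteq> {})}"
        by blast
    qed
    ultimately show ?thesis
      by (rule infinite_super[rotated])
  qed
  show thesis
  proof (rule that[of "K \<union> L"])
    \<comment> \<open>Were it empty, the open set \<open>{}\<close> would contain infinitely many of the nonempty terms.\<close>
    have "K \<union> L \<noteq> {}"
    proof
      assume "K \<union> L = {}"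
      then have "infinite {j. Inl ` G (m j) \<subseteq> ({} :: (nat + nat set) set)}"
        using main[of "{}" "{}"] by simp
      then show False using G(2) by simp
    qed
    moreover have "closedin (Psi A) (K \<union> L)"
      using L unfolding K_def by (intro closedin_Un) auto
    ultimately show "K \<union> L \<in> closed_subsets (Psi A)"
      by (simp add: closed_subsets_def)
    show "\<forall>W. openin (Vietoris (Psi A)) W \<longrightarrow> K \<union> L \<in> W \<longrightarrow> infinite {n. Inl ` G n \<in> W}"
    proof (intro allI impI)
      fix W assume W: "openin (Vietoris (Psi A)) W" "K \<union> L \<in> W"
      obtain U \<V> where U: "openin (Psi A) U" "finite \<V>" and V: "\<forall>V\<in>\<V>. openin (Psi A) V"
        and KL: "K \<union> L \<in> Vietoris_box (Psi A) U \<V>" and W': "Vietoris_box (Psi A) U \<V> \<subseteq> W"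
        using W by (rule Vietoris_box_neighbourhood)
      let ?J = "{j. Inl ` G (m j) \<subseteq> U \<and> (\<forall>V\<in>\<V>. Inl ` G (m j) \<inter> V \<noteq> {})}"
      have "infinite ?J"
        using U V KL by (intro main) (auto simp: Vietoris_box_def)
      then have "infinite (m ` ?J)"
        using m by (simp add: finite_image_iff strict_mono_imp_inj_on inj_on_subset)
      moreover have "m ` ?J \<subseteq> {n. Inl ` G n \<in> W}"
      proof (intro image_subsetI CollectI)
        fix j assume "j \<in> ?J"
        then have "Inl ` G (m j) \<in> Vietoris_box (Psi A) U \<V>"
          using Inl_image_closed_subset[OF G] by (simp add: Vietoris_box_def)
        then show "Inl ` G (m j) \<in> W"
          using W' by blast
      qed
      ultimately show "infinite {n. Inl ` G n \<in> W}"
        by (rule infinite_super[rotated])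
    qed
  qed
qed


section \<open>Pseudocompactness\<close>

theorem pseudocompact_family_if_fin_intersecting:
  assumes MAD: "MAD_family A" and fi: "fin_intersecting A"
  shows "pseudocompact_family A"
  unfolding pseudocompact_family_def pseudocompact_space_def
proof (intro allI impI)
  let ?X = "Vietoris (Psi A)"
  fix f assume f: "continuous_map ?X euclideanreal f"
  have op: "openin ?X {F \<in> topspace ?X. f F \<in> T}" if "open T" for T
    using f that by (simp add: openin_continuous_map_preimage)
  have A: "infinite a" if "a \<in> A" for a
    using MAD that unfolding MAD_family_def almost_disjoint_family_def by blast
  show "bounded (f ` topspace ?X)"
  proof (rule ccontr)
    assume unb: "\<not> bounded (f ` topspace ?X)"
    have "\<exists>G. finite G \<and> G \<noteq> {} \<and> real n < \<bar>f (Inl ` G)\<bar>" for n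
    proof -
      obtain P where P: "P \<in> topspace ?X" "real n < \<bar>f P\<bar>"
        using unb unfolding bounded_iff by (auto simp: not_le)
      let ?T = "{x :: real. real n < \<bar>x\<bar>}"
      have T: "open ?T"
        by (intro open_Collect_less continuous_intros)
      have PT: "P \<in> {F \<in> topspace ?X. f F \<in> ?T}"
        using P by simp
      obtain F where "finite F" "F \<noteq> {}" "Inl ` F \<in> {F \<in> topspace ?X. f F \<in> ?T}"
        using A op[OF T] PT by (rule finite_sets_dense_in_Vietoris_Psi)
      then show ?thesis by blast
    qed
    then obtain G where G: "\<And>n. finite (G n)" "\<And>n. G n \<noteq> {}"
      and big: "\<And>n. real n < \<bar>f (Inl ` G n)\<bar>"
      by metis
    obtain P where P: "P \<in> closed_subsets (Psi A)"
      and cluster: "\<forall>W. openin ?X W \<longrightarrow> P \<in> W \<longrightarrow> infinite {n. Inl ` G n \<in> W}"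
      using MAD fi G by (rule finite_sets_cluster_in_Vietoris)
    let ?W = "{F \<in> topspace ?X. f F \<in> {x. \<bar>x\<bar> < \<bar>f P\<bar> + 1}}"
    have "open {x. \<bar>x\<bar> < \<bar>f P\<bar> + 1}"
      by (intro open_Collect_less continuous_intros)
    then have "openin ?X ?W"
      by (rule op)
    moreover have "P \<in> ?W"
      using P by (simp add: topspace_Vietoris)
    ultimately have "infinite {n. Inl ` G n \<in> ?W}"
      using cluster by blast
    moreover have "{n. Inl ` G n \<in> ?W} \<subseteq> {..<nat \<lceil>\<bar>f P\<bar> + 1\<rceil>}"
    proof
      fix n assume "n \<in> {n. Inl ` G n \<in> ?W}"
      then have "real n < \<bar>f P\<bar> + 1"
        using big[of n] by simp
      then show "n \<in> {..<nat \<lceil>\<bar>f P\<bar> + 1\<rceil>}"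
        by simp linarith
    qed
    ultimately show False
      by (meson finite_lessThan finite_subset)
  qed
qed

theorem corollary12:
  assumes "almost_disjointness_number <o splitting_number"
  shows "(\<exists>A. MAD_family A \<and> fin_intersecting A) \<and>
         (\<exists>A. MAD_family A \<and> pseudocompact_family A)"
proof -
  obtain M where "MAD_family M" using MAD_family_exists by blast
  from least_card_props(1)[of MAD_family, OF this]
  obtain A where A: "MAD_family A" "almost_disjointness_number = |A|"
    unfolding almost_disjointness_number_def by blast
  then have "fin_intersecting A"
    using assms by (intro fin_intersecting_if_small) simp
  then show ?thesis
    using A(1) pseudocompact_family_if_fin_intersecting by blast
qed

end
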